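(* Let $x$ and $y$ be observables on a $\sigma$-lattice effect algebra $E$. Then $x\preceq_s y$ if and only if $y((-\infty,t])\le x((-\infty,t])$ for each $t\in\mathbb R$.
   Context: An effect algebra is a partial algebra $(E;+,0,1)$ with a partially defined binary operation $+$ such that for all $a,b,c\in E$: (i) $a+b$ is defined iff $b+a$ is, and then $a+b=b+a$; (ii) $a+b$ and $(a+b)+c$ are defined iff $b+c$ and $a+(b+c)$ are defined, and then $(a+b)+c=a+(b+c)$; (iii) for each $a$ there is a unique $a'\in E$ with $a+a'=1$; (iv) if $a+1$ is defined, then $a=0$. The partial order is $a\le b$ iff $a+c=b$ for some $c\in E$. $E$ is a $\sigma$-lattice effect algebra if $(E,\le)$ is a lattice in which all countable suprema and infima exist. Let $\mathcal B(\mathbb R)$ be the Borel $\sigma$-algebra of $\mathbb R$. An observable on $E$ is a map $x:\mathcal B(\mathbb R)\to E$ such that (i) $x(\mathbb R)=1$; (ii) if $B\cap C=\emptyset$, then $x(B)+x(C)$ is defined and $x(B\cup C)=x(B)+x(C)$; (iii) if $B_i\subseteq B_{i+1}$ for all $i$ and $B=\bigcup_i B_i$, then $x(B)=\bigvee_i x(B_i)$. The Olson order on observables is: $x\preceq_s y$ iff $y((-\infty,t))\le x((-\infty,t))$ for every $t\in\mathbb R$. *)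

theory Defs
  imports "HOL-Analysis.Borel_Space" "HOL-Algebra.Lattice"
begin

text \<open>The partial operation is option-valued: \<open>None\<close> means that the sum is undefined.\<close>

record 'a eff_alg = "'a partial_object" +
  padd :: "'a \<Rightarrow> 'a \<Rightarrow> 'a option" (infixl "\<oplus>\<index>" 65)
  zero :: 'a ("\<zero>\<index>")
  one :: 'a ("\<one>\<index>")

locale effect_algebra =
  fixes E (structure)
  assumes zero_closed: "\<zero> \<in> carrier E"
    and one_closed: "\<one> \<in> carrier E"
    and padd_closed:
      "\<lbrakk>a \<in> carrier E; b \<in> carrier E; a \<oplus> b = Some c\<rbrakk> \<Longrightarrow> c \<in> carrier E"
    and padd_commute: "\<lbrakk>a \<in> carrier E; b \<in> carrier E\<rbrakk> \<Longrightarrow> a \<oplus> b = b \<oplus> a"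
    and padd_assoc:
      "\<lbrakk>a \<in> carrier E; b \<in> carrier E; c \<in> carrier E\<rbrakk> \<Longrightarrow>
        (\<exists>s. a \<oplus> b = Some s \<and> s \<oplus> c = Some r) \<longleftrightarrow> (\<exists>s. b \<oplus> c = Some s \<and> a \<oplus> s = Some r)"
    and ex1_compl: "a \<in> carrier E \<Longrightarrow> \<exists>!a'. a' \<in> carrier E \<and> a \<oplus> a' = Some \<one>"
    and padd_one: "\<lbrakk>a \<in> carrier E; a \<oplus> \<one> \<noteq> None\<rbrakk> \<Longrightarrow> a = \<zero>"

definition eff_le :: "('a, 'm) eff_alg_scheme \<Rightarrow> 'a \<Rightarrow> 'a \<Rightarrow> bool" where
  "eff_le E a b \<longleftrightarrow> (\<exists>c\<in>carrier E. padd E a c = Some b)"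

definition eff_order :: "('a, 'm) eff_alg_scheme \<Rightarrow> 'a gorder" where
  "eff_order E = \<lparr>carrier = carrier E, eq = (=), le = eff_le E\<rparr>"

text \<open>The case \<open>A = {}\<close> is harmless, since \<open>\<zero>\<close> and \<open>\<one>\<close> are the bounds of an effect algebra.\<close>

locale sigma_lattice_effect_algebra =
  effect_algebra E + lattice "eff_order E" for E (structure) +
  assumes countable_sup:
      "\<lbrakk>countable A; A \<subseteq> carrier E\<rbrakk> \<Longrightarrow> \<exists>s. least (eff_order E) s (Upper (eff_order E) A)"
    and countable_inf:
      "\<lbrakk>countable A; A \<subseteq> carrier E\<rbrakk> \<Longrightarrow> \<exists>i. greatest (eff_order E) i (Lower (eff_order E) A)"

text \<open>An observable is only meaningful on Borel sets; its values elsewhere are unconstrained.\<close>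

definition observable :: "('a, 'm) eff_alg_scheme \<Rightarrow> (real set \<Rightarrow> 'a) \<Rightarrow> bool" where
  "observable E x \<longleftrightarrow>
    x ` sets borel \<subseteq> carrier E \<and>
    x UNIV = one E \<and>
    (\<forall>B\<in>sets borel. \<forall>C\<in>sets borel. B \<inter> C = {} \<longrightarrow> padd E (x B) (x C) = Some (x (B \<union> C))) \<and>
    (\<forall>B :: nat \<Rightarrow> real set. (\<forall>i. B i \<in> sets borel) \<and> (\<forall>i. B i \<subseteq> B (Suc i)) \<longrightarrow>
      least (eff_order E) (x (\<Union>i. B i)) (Upper (eff_order E) (range (\<lambda>i. x (B i)))))"

definition olson_le ::
  "('a, 'm) eff_alg_scheme \<Rightarrow> (real set \<Rightarrow> 'a) \<Rightarrow> (real set \<Rightarrow> 'a) \<Rightarrow> bool" where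
  "olson_le E x y \<longleftrightarrow> (\<forall>t::real. eff_le E (y {..<t}) (x {..<t}))"

end

theory Submission
  imports Defs
begin

text \<open>
  Both directions rest on one fact: an inequality between two observables that holds along an
  increasing sequence of Borel sets passes to the union, because an observable sends increasing
  unions to suprema.

  The half-line \<open>{..<t}\<close> is the increasing union of the closed half-lines \<open>{..t - 1/(n+1)}\<close>, so
  comparison on closed half-lines gives comparison on open ones. Conversely, \<open>{..t}\<close> is a
  decreasing intersection of open half-lines, and observables are only required to preserve
  increasing unions. But \<open>x (- B)\<close> is the orthosupplement of \<open>x B\<close>, and taking orthosupplements
  reverses the order. After complementation the claim is therefore about \<open>{t<..}\<close>, which is the
  increasing union of the sets \<open>{t + 1/(n+1)..}\<close>, the complements of open half-lines.
\<close>

context effect_algebra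
begin

lemma eff_le_trans:
  assumes "a \<in> carrier E" "eff_le E a b" "eff_le E b c"
  shows "eff_le E a c"
proof -
  from assms obtain d e where d: "d \<in> carrier E" "a \<oplus> d = Some b"
    and e: "e \<in> carrier E" "b \<oplus> e = Some c"
    by (auto simp: eff_le_def)
  then obtain s where "d \<oplus> e = Some s" "a \<oplus> s = Some c"
    using padd_assoc[OF assms(1) d(1) e(1)] by blast
  then show ?thesis
    using padd_closed[OF d(1) e(1)] by (auto simp: eff_le_def)
qed

text \<open>If \<open>b = a + c\<close>, then \<open>1 = (a + c) + b' = a + (c + b')\<close>, and uniqueness of the orthosupplement
  of \<open>a\<close> forces \<open>a' = c + b'\<close>.\<close>

lemma orthosupplement_antimono:
  assumes "a \<in> carrier E" "a' \<in> carrier E" "b' \<in> carrier E"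
    and a': "a \<oplus> a' = Some \<one>" and b': "b \<oplus> b' = Some \<one>"
    and "eff_le E a b"
  shows "eff_le E b' a'"
proof -
  from \<open>eff_le E a b\<close> obtain c where c: "c \<in> carrier E" "a \<oplus> c = Some b"
    by (auto simp: eff_le_def)
  then obtain s where s: "c \<oplus> b' = Some s" "a \<oplus> s = Some \<one>"
    using padd_assoc[OF assms(1) c(1) assms(3)] b' by blast
  have "s = a'"
    using ex1_compl[OF assms(1)] padd_closed[OF c(1) assms(3) s(1)] s(2) assms(2) a' by blast
  then show ?thesis
    using s(1) c(1) padd_commute[OF c(1) assms(3)] by (auto simp: eff_le_def)
qed

end

lemma observable_closed:
  "observable E x \<Longrightarrow> B \<in> sets borel \<Longrightarrow> x B \<in> carrier E"
  by (auto simp: observable_def)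

lemma observable_add:
  assumes "observable E x" "B \<in> sets borel" "C \<in> sets borel" "B \<inter> C = {}"
  shows "padd E (x B) (x C) = Some (x (B \<union> C))"
  using assms by (auto simp: observable_def)

lemma observable_mono:
  assumes "observable E x" "B \<in> sets borel" "C \<in> sets borel" "B \<subseteq> C"
  shows "eff_le E (x B) (x C)"
proof -
  have "padd E (x B) (x (C - B)) = Some (x (B \<union> (C - B)))"
    using assms by (intro observable_add) auto
  moreover have "B \<union> (C - B) = C"
    using assms(4) by blast
  ultimately show ?thesis
    using observable_closed[OF assms(1), of "C - B"] assms(2,3) by (auto simp: eff_le_def)
qed

lemma observable_Compl:
  assumes "observable E x" "B \<in> sets borel"
  shows "padd E (x B) (x (- B)) = Some (one E)"
  using observable_add[OF assms(1,2), of "- B"] assms by (simp add: borel_comp observable_def)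

lemma observable_Compl_le:
  assumes "effect_algebra E" "observable E x" "observable E y" "B \<in> sets borel"
    and "eff_le E (y B) (x B)"
  shows "eff_le E (x (- B)) (y (- B))"
proof (rule effect_algebra.orthosupplement_antimono[OF assms(1)])
  show "y B \<in> carrier E" "y (- B) \<in> carrier E" "x (- B) \<in> carrier E"
    using assms(4) by (simp_all add: observable_closed[OF assms(2)] observable_closed[OF assms(3)]
      borel_comp)
  show "padd E (y B) (y (- B)) = Some (one E)" "padd E (x B) (x (- B)) = Some (one E)"
    using assms(4) by (simp_all add: observable_Compl[OF assms(2)] observable_Compl[OF assms(3)])
qed (rule assms(5))

text \<open>By monotonicity of \<open>x\<close>, the value \<open>x (\<Union>i. B i)\<close> is an upper bound of all \<open>y (B i)\<close>, hence it
  dominates their supremum, which is \<open>y (\<Union>i. B i)\<close>.\<close>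

lemma observable_le_UN:
  fixes B :: "nat \<Rightarrow> real set"
  assumes "effect_algebra E" "observable E x" "observable E y"
    and B: "\<And>i. B i \<in> sets borel" "\<And>i. B i \<subseteq> B (Suc i)"
    and le: "\<And>i. eff_le E (y (B i)) (x (B i))"
  shows "eff_le E (y (\<Union>i. B i)) (x (\<Union>i. B i))"
proof -
  have UN: "(\<Union>i. B i) \<in> sets borel"
    using B(1) by blast
  have "eff_le E (y (B i)) (x (\<Union>i. B i))" for i
  proof (rule effect_algebra.eff_le_trans[OF assms(1)])
    show "y (B i) \<in> carrier E"
      using assms(3) B(1) by (rule observable_closed)
    show "eff_le E (x (B i)) (x (\<Union>i. B i))"
      by (rule observable_mono[OF assms(2) B(1) UN]) blast
  qed (rule le)
  then have "x (\<Union>i. B i) \<in> Upper (eff_order E) (range (\<lambda>i. y (B i)))"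
    using observable_closed[OF assms(2) UN] by (auto simp: Upper_def eff_order_def)
  moreover have "least (eff_order E) (y (\<Union>i. B i)) (Upper (eff_order E) (range (\<lambda>i. y (B i))))"
    using assms(3) B by (simp add: observable_def)
  ultimately show ?thesis
    by (auto simp: least_def eff_order_def)
qed

lemma lessThan_eq_UN_atMost:
  "{..<t::real} = (\<Union>n. {..t - 1 / real (Suc n)})"
proof (intro equalityI subsetI)
  fix s assume "s \<in> {..<t}"
  then obtain n where "1 / real (Suc n) < t - s"
    using nat_approx_posE[of "t - s"] by auto
  then have "s \<in> {..t - 1 / real (Suc n)}"
    by simp
  then show "s \<in> (\<Union>n. {..t - 1 / real (Suc n)})"
    by blast
next
  fix s assume "s \<in> (\<Union>n. {..t - 1 / real (Suc n)})"
  then obtain n where "s \<le> t - 1 / real (Suc n)"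
    by auto
  moreover have "0 < 1 / real (Suc n)"
    by simp
  ultimately show "s \<in> {..<t}"
    unfolding lessThan_iff by linarith
qed

lemma greaterThan_eq_UN_atLeast:
  "{t::real<..} = (\<Union>n. {t + 1 / real (Suc n)..})"
proof (intro equalityI subsetI)
  fix s assume "s \<in> {t<..}"
  then obtain n where "1 / real (Suc n) < s - t"
    using nat_approx_posE[of "s - t"] by auto
  then have "s \<in> {t + 1 / real (Suc n)..}"
    by simp
  then show "s \<in> (\<Union>n. {t + 1 / real (Suc n)..})"
    by blast
next
  fix s assume "s \<in> (\<Union>n. {t + 1 / real (Suc n)..})"
  then obtain n where "t + 1 / real (Suc n) \<le> s"
    by auto
  moreover have "0 < 1 / real (Suc n)"
    by simp
  ultimately show "s \<in> {t<..}"
    unfolding greaterThan_iff by linarith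
qed

theorem lemma4p2:
  fixes E :: "('a, 'm) eff_alg_scheme"
    and x y :: "real set \<Rightarrow> 'a"
  assumes "sigma_lattice_effect_algebra E"
    and "observable E x"
    and "observable E y"
  shows "olson_le E x y \<longleftrightarrow> (\<forall>t::real. eff_le E (y {..t}) (x {..t}))"
proof
  have E: "effect_algebra E"
    using assms(1) by (simp add: sigma_lattice_effect_algebra_def)
  have step: "1 / real (Suc (Suc n)) \<le> 1 / real (Suc n)" for n
    by (rule divide_left_mono) simp_all
  {
    assume open_le: "olson_le E x y"
    have ge: "eff_le E (x {s..}) (y {s..})" for s
    proof -
      have "eff_le E (x (- {..<s})) (y (- {..<s}))"
        using open_le by (intro observable_Compl_le[OF E assms(2,3)]) (simp_all add: olson_le_def)
      then show ?thesis
        by simp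
    qed
    have gt: "eff_le E (x {t<..}) (y {t<..})" for t
      unfolding greaterThan_eq_UN_atLeast
    proof (rule observable_le_UN[OF E assms(3,2)])
      show "{t + 1 / real (Suc n)..} \<subseteq> {t + 1 / real (Suc (Suc n))..}" for n
        using step[of n] by (simp only: atLeast_subset_iff add_le_cancel_left)
    qed (simp_all add: ge del: of_nat_Suc)
    show "\<forall>t. eff_le E (y {..t}) (x {..t})"
    proof
      fix t
      have "eff_le E (y (- {t<..})) (x (- {t<..}))"
        using gt by (intro observable_Compl_le[OF E assms(3,2)]) simp_all
      then show "eff_le E (y {..t}) (x {..t})"
        by simp
    qed
  next
    assume closed_le: "\<forall>t. eff_le E (y {..t}) (x {..t})"
    have "eff_le E (y {..<t}) (x {..<t})" for t
      unfolding lessThan_eq_UN_atMost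
    proof (rule observable_le_UN[OF E assms(2,3)])
      show "{..t - 1 / real (Suc n)} \<subseteq> {..t - 1 / real (Suc (Suc n))}" for n
        using step[of n] by (simp only: atMost_subset_iff diff_left_mono)
    qed (simp_all add: closed_le del: of_nat_Suc)
    then show "olson_le E x y"
      by (simp add: olson_le_def)
  }
qed

end
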